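(* Let $m\geq 3$ and let $n$ be an even positive integer. Then the stacked-book graph $G=G_{m,n}=S_m\Box P_n$ satisfies $$rn(G)\geq \frac{mn^2}{2}+n-1.$$
   Context: $S_m$ denotes the star on $m$ vertices (one center vertex adjacent to $m-1$ leaves) and $P_n$ the path on $n$ vertices. The stacked-book graph $G_{m,n}=S_m \Box P_n$ is their Cartesian product. For a simple connected graph $G$ with distance $d$ and diameter $\mathrm{diam}(G)$, a radio labeling is a function $f:V(G)\to \mathbb{Z}_{\ge 0}$ such that $|f(u)-f(v)|\geq \mathrm{diam}(G)+1-d(u,v)$ for all distinct $u,v\in V(G)$. The span of $f$ is $\max_{v} f(v)-\min_{v} f(v)$. The radio number $rn(G)$ is the minimum span over all radio labelings of $G$. *)

theory Defs
  imports Complex_Main "Graph_Theory.Graph_Theory"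
begin

text \<open>Simple graphs are symmetric loop-free digraphs whose arcs are pairs of vertices
  (locale \<^locale>\<open>pair_graph\<close>): an edge is a pair of opposite arcs.\<close>

definition star_graph :: "nat \<Rightarrow> nat pair_pre_digraph" where
  "star_graph m =
     \<lparr>pverts = {..<m}, parcs = {(u, v). u < m \<and> v < m \<and> u \<noteq> v \<and> (u = 0 \<or> v = 0)}\<rparr>"

definition path_graph :: "nat \<Rightarrow> nat pair_pre_digraph" where
  "path_graph n =
     \<lparr>pverts = {..<n}, parcs = {(i, j). i < n \<and> j < n \<and> (j = Suc i \<or> i = Suc j)}\<rparr>"

definition cartesian_product ::
    "'a pair_pre_digraph \<Rightarrow> 'b pair_pre_digraph \<Rightarrow> ('a \<times> 'b) pair_pre_digraph"
    (infixl \<open>\<box>\<close> 70) where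
  "G \<box> H =
     \<lparr>pverts = pverts G \<times> pverts H,
      parcs = {((u, x), (v, y)).
                 u = v \<and> u \<in> pverts G \<and> (x, y) \<in> parcs H \<or>
                 x = y \<and> x \<in> pverts H \<and> (u, v) \<in> parcs G}\<rparr>"

definition stacked_book :: "nat \<Rightarrow> nat \<Rightarrow> (nat \<times> nat) pair_pre_digraph" where
  "stacked_book m n = star_graph m \<box> path_graph n"

text \<open>The following minima and maxima are only meaningful for finite, nonempty,
  connected graphs.\<close>

definition graph_dist :: "'a pair_pre_digraph \<Rightarrow> 'a \<Rightarrow> 'a \<Rightarrow> nat" where
  "graph_dist G u v = (LEAST k. \<exists>p. pre_digraph.awalk (with_proj G) u p v \<and> length p = k)"

definition graph_diam :: "'a pair_pre_digraph \<Rightarrow> nat" where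
  "graph_diam G = Max {graph_dist G u v | u v. u \<in> pverts G \<and> v \<in> pverts G}"

definition radio_labeling :: "'a pair_pre_digraph \<Rightarrow> ('a \<Rightarrow> nat) \<Rightarrow> bool" where
  "radio_labeling G f \<longleftrightarrow>
     (\<forall>u\<in>pverts G. \<forall>v\<in>pverts G. u \<noteq> v \<longrightarrow>
        \<bar>int (f u) - int (f v)\<bar> \<ge> int (graph_diam G) + 1 - int (graph_dist G u v))"

definition label_span :: "'a pair_pre_digraph \<Rightarrow> ('a \<Rightarrow> nat) \<Rightarrow> nat" where
  "label_span G f = Max (f ` pverts G) - Min (f ` pverts G)"

definition radio_number :: "'a pair_pre_digraph \<Rightarrow> nat" where
  "radio_number G = (LEAST k. \<exists>f. radio_labeling G f \<and> label_span G f = k)"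

lemma pair_graph_star: "pair_graph (star_graph m)"
proof -
  have "parcs (star_graph m) \<subseteq> {..<m} \<times> {..<m}" by (auto simp: star_graph_def)
  then have "finite (parcs (star_graph m))" by (rule finite_subset) simp
  then show ?thesis
    by unfold_locales (auto simp: star_graph_def symmetric_def sym_def)
qed

lemma pair_graph_path: "pair_graph (path_graph n)"
proof -
  have "parcs (path_graph n) \<subseteq> {..<n} \<times> {..<n}" by (auto simp: path_graph_def)
  then have "finite (parcs (path_graph n))" by (rule finite_subset) simp
  then show ?thesis
    by unfold_locales (auto simp: path_graph_def symmetric_def sym_def)
qed

lemma pair_graph_cartesian_product:
  assumes "pair_graph G" "pair_graph H"
  shows "pair_graph (G \<box> H)"
proof -
  interpret G: pair_graph G by fact
  interpret H: pair_graph H by fact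
  have sub: "parcs (G \<box> H) \<subseteq> (pverts G \<times> pverts H) \<times> (pverts G \<times> pverts H)"
    by (auto simp: cartesian_product_def dest: G.wellformed' H.wellformed')
  then have fin: "finite (parcs (G \<box> H))"
    by (rule finite_subset) (simp add: G.pair_finite_verts H.pair_finite_verts)
  have symG: "(v, u) \<in> parcs G" if "(u, v) \<in> parcs G" for u v
    using G.pair_sym_arcs that by (auto simp: symmetric_def sym_def)
  have symH: "(v, u) \<in> parcs H" if "(u, v) \<in> parcs H" for u v
    using H.pair_sym_arcs that by (auto simp: symmetric_def sym_def)
  show ?thesis
  proof unfold_locales
    show "symmetric (with_proj (G \<box> H))"
      by (auto simp: symmetric_def sym_def cartesian_product_def intro: symG symH)
  next
    fix e assume "e \<in> parcs (G \<box> H)"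
    then show "fst e \<noteq> snd e"
      by (auto simp: cartesian_product_def dest: G.pair_no_loops H.pair_no_loops)
  qed (use fin in \<open>auto simp: cartesian_product_def G.pair_finite_verts H.pair_finite_verts
             dest: G.wellformed' H.wellformed'\<close>)
qed

lemma pair_graph_stacked_book: "pair_graph (stacked_book m n)"
  unfolding stacked_book_def
  by (intro pair_graph_cartesian_product pair_graph_star pair_graph_path)

lemma connected_stacked_book:
  assumes "0 < m" "0 < n"
  shows "connected (with_proj (stacked_book m n))"
proof -
  interpret pair_graph "stacked_book m n" by (rule pair_graph_stacked_book)
  have row: "(0, i) \<rightarrow>\<^sup>*\<^bsub>stacked_book m n\<^esub> (0, 0)" if "i < n" for i
    using that
  proof (induction i)
    case 0
    have "(0, 0) \<in> pverts (stacked_book m n)" using assms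
      by (auto simp: stacked_book_def cartesian_product_def star_graph_def path_graph_def)
    then show ?case by simp
  next
    case (Suc i)
    then have "((0, Suc i), (0, i)) \<in> parcs (stacked_book m n)" using assms
      by (auto simp: stacked_book_def cartesian_product_def star_graph_def path_graph_def)
    then show ?case using Suc by (auto intro: adj_reachable_trans)
  qed
  have to0: "x \<rightarrow>\<^sup>*\<^bsub>stacked_book m n\<^esub> (0, 0)" if xV: "x \<in> pverts (stacked_book m n)" for x
  proof -
    obtain u i where x: "x = (u, i)" "u < m" "i < n"
      using xV by (auto simp: stacked_book_def cartesian_product_def star_graph_def path_graph_def)
    show ?thesis
    proof (cases "u = 0")
      case False
      then have "((u, i), (0, i)) \<in> parcs (stacked_book m n)" using x
        by (auto simp: stacked_book_def cartesian_product_def star_graph_def path_graph_def)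
      then show ?thesis using row x by (auto intro: adj_reachable_trans)
    qed (use row x in simp)
  qed
  have sym: "symmetric (with_proj (stacked_book m n))" by (rule pair_sym_arcs)
  have "strongly_connected (with_proj (stacked_book m n))"
  proof (rule strongly_connectedI)
    show "verts (with_proj (stacked_book m n)) \<noteq> {}" using assms
      by (auto simp: stacked_book_def cartesian_product_def star_graph_def path_graph_def)
  next
    fix x y assume "x \<in> verts (with_proj (stacked_book m n))" "y \<in> verts (with_proj (stacked_book m n))"
    then have "x \<rightarrow>\<^sup>*\<^bsub>stacked_book m n\<^esub> (0, 0)" "(0, 0) \<rightarrow>\<^sup>*\<^bsub>stacked_book m n\<^esub> y"
      using to0[of x] symmetric_reachable[OF sym to0[of y]] by simp_all
    then show "x \<rightarrow>\<^sup>*\<^bsub>stacked_book m n\<^esub> y" by (rule reachable_trans)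
  qed
  moreover have "mk_symmetric (with_proj (stacked_book m n)) = stacked_book m n"
    using sym by (auto simp: mk_symmetric_def symmetric_def sym_def intro!: pair_pre_digraph.equality)
  ultimately show ?thesis by (simp add: connected_def)
qed

lemma ex_radio_labeling:
  assumes "finite (pverts G)"
  shows "\<exists>f. radio_labeling G f"
proof -
  obtain g :: "'a \<Rightarrow> nat" where g: "inj_on g (pverts G)"
    using finite_imp_inj_to_nat_seg[OF assms] by blast
  define D where "D = graph_diam G + 1"
  have "radio_labeling G (\<lambda>v. D * g v)"
    unfolding radio_labeling_def
  proof (intro ballI impI)
    fix u v assume "u \<in> pverts G" "v \<in> pverts G" "u \<noteq> v"
    then have "g u \<noteq> g v" using g by (auto dest: inj_onD)
    then have "1 \<le> \<bar>int (g u) - int (g v)\<bar>" by linarith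
    then have "int D * 1 \<le> int D * \<bar>int (g u) - int (g v)\<bar>"
      by (intro mult_left_mono) auto
    also have "\<dots> = \<bar>int (D * g u) - int (D * g v)\<bar>"
      by (simp add: abs_mult flip: right_diff_distrib)
    finally show "int (graph_diam G) + 1 - int (graph_dist G u v)
        \<le> \<bar>int (D * g u) - int (D * g v)\<bar>"
      by (simp add: D_def)
  qed
  then show ?thesis by blast
qed

end

theory Submission
  imports Defs
begin

text \<open>Put \<open>c (u, i) = 2 [u \<noteq> 0] + \<bar>2 i + 1 - n\<bar>\<close>. Going through the spine of the book shows
  \<open>2 d(x, y) \<le> c x + c y\<close>. List the \<open>m n\<close> vertices by increasing label: consecutive labels differ by
  at least \<open>n + 2 - d\<close>, so telescoping bounds twice the span below by
  \<open>2 (m n - 1) (n + 2) - 2 \<Sum> c\<close> plus the values of \<open>c\<close> at the first and last vertex. These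
  are at least 1 each because \<open>n\<close> is even, and \<open>\<Sum> c = 2 (m - 1) n + m n\<^sup>2 / 2\<close>.\<close>

lemma graph_dist_le:
  assumes "pre_digraph.awalk (with_proj G) u p v"
  shows "graph_dist G u v \<le> length p"
  unfolding graph_dist_def by (rule Least_le) (use assms in blast)

text \<open>\<open>LEAST\<close> is attained only if some walk exists; the given walk guarantees
  this.\<close>

lemma graph_dist_attained:
  assumes "pre_digraph.awalk (with_proj G) u p v"
  obtains q where "pre_digraph.awalk (with_proj G) u q v" "length q = graph_dist G u v"
  using LeastI_ex[of "\<lambda>k. \<exists>p. pre_digraph.awalk (with_proj G) u p v \<and> length p = k"] assms
  unfolding graph_dist_def by blast

text \<open>A potential that rises by at most 1 along each arc certifies a lower bound on the length
  of every walk, and so on distances.\<close>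

lemma awalk_length_ge_potential:
  fixes g :: "'a \<Rightarrow> int"
  assumes "pair_graph G"
    and lip: "\<And>x y. (x, y) \<in> parcs G \<Longrightarrow> g y \<le> g x + 1"
    and "pre_digraph.awalk (with_proj G) u p v"
  shows "g v \<le> g u + int (length p)"
proof -
  interpret pair_graph G by fact
  show ?thesis using assms(3)
  proof (induction p arbitrary: u)
    case (Cons e p)
    then have "e \<in> parcs G" "fst e = u" "awalk (snd e) p v"
      by (auto simp: awalk_Cons_iff)
    then show ?case using Cons.IH[of "snd e"] lip[of u "snd e"] by force
  qed (auto simp: awalk_Nil_iff)
qed

lemma pverts_stacked_book: "pverts (stacked_book m n) = {..<m} \<times> {..<n}"
  by (simp add: stacked_book_def cartesian_product_def star_graph_def path_graph_def)

lemma parcs_stacked_book: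
  "((u, i), (v, j)) \<in> parcs (stacked_book m n) \<longleftrightarrow>
     u < m \<and> v < m \<and> i < n \<and> j < n \<and>
     (u = v \<and> (j = Suc i \<or> i = Suc j) \<or> i = j \<and> u \<noteq> v \<and> (u = 0 \<or> v = 0))"
  by (auto simp: stacked_book_def cartesian_product_def star_graph_def path_graph_def)

lemma ex_spine_awalk:
  assumes "0 < m" "i < n" "j < n"
  shows "\<exists>p. pre_digraph.awalk (with_proj (stacked_book m n)) (0, i) p (0, j)
    \<and> int (length p) = \<bar>int i - int j\<bar>"
  using assms(2)
proof (induction "nat \<bar>int i - int j\<bar>" arbitrary: i)
  interpret pair_graph "stacked_book m n" by (rule pair_graph_stacked_book)
  case 0
  then have "awalk (0, i) [] (0, j)" using assms
    by (auto simp: awalk_Nil_iff pverts_stacked_book)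
  with 0 show ?case by force
next
  interpret pair_graph "stacked_book m n" by (rule pair_graph_stacked_book)
  case (Suc k)
  \<comment> \<open>The neighbour of \<open>i\<close> one step closer to \<open>j\<close>. Here
    \<open>i \<noteq> j\<close>, so in the second case \<open>i > j\<close> and the subtraction does
    not truncate.\<close>
  define i' where "i' = (if i < j then Suc i else i - 1)"
  have i': "i' < n" "k = nat \<bar>int i' - int j\<bar>" "i' = Suc i \<or> i = Suc i'"
    "\<bar>int i - int j\<bar> = \<bar>int i' - int j\<bar> + 1"
    using Suc assms by (auto simp: i'_def)
  obtain p where p: "awalk (0, i') p (0, j)" "int (length p) = \<bar>int i' - int j\<bar>"
    using Suc.hyps(1)[OF i'(2,1)] by blast
  have "((0, i), (0, i')) \<in> parcs (stacked_book m n)"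
    using i' Suc.prems assms by (auto simp: parcs_stacked_book)
  then have "awalk (0, i) (((0, i), (0, i')) # p) (0, j)"
    using p Suc.prems assms by (auto simp: awalk_Cons_iff pverts_stacked_book)
  moreover have "int (length (((0::nat, i), (0::nat, i')) # p)) = \<bar>int i - int j\<bar>"
    using p i' by simp
  ultimately show ?case by blast
qed

text \<open>Step to the centre, follow the spine, step out again. If \<open>u = v \<noteq> 0\<close>
  the detour is 2 longer than the direct route, which is harmless for an upper bound on
  distances.\<close>

lemma ex_awalk_via_spine:
  assumes "u < m" "v < m" "i < n" "j < n"
  shows "\<exists>p. pre_digraph.awalk (with_proj (stacked_book m n)) (u, i) p (v, j)
    \<and> int (length p) = of_bool (u \<noteq> 0) + \<bar>int i - int j\<bar> + of_bool (v \<noteq> 0)"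
proof -
  interpret pair_graph "stacked_book m n" by (rule pair_graph_stacked_book)
  obtain p where p: "awalk (0, i) p (0, j)" "int (length p) = \<bar>int i - int j\<bar>"
    using ex_spine_awalk[of m i n j] assms by auto
  define q where "q = (if u = 0 then [] else [((u, i), (0::nat, i))])"
  define r where "r = (if v = 0 then [] else [((0::nat, j), (v, j))])"
  have "awalk (u, i) q (0, i)" "awalk (0, j) r (v, j)"
    using assms
    by (auto simp: q_def r_def awalk_Nil_iff awalk_Cons_iff pverts_stacked_book parcs_stacked_book)
  with p have "awalk (u, i) (q @ p @ r) (v, j)" by (intro awalk_appendI)
  moreover have "int (length (q @ p @ r)) =
      of_bool (u \<noteq> 0) + \<bar>int i - int j\<bar> + of_bool (v \<noteq> 0)"
    using p by (simp add: q_def r_def)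
  ultimately show ?thesis by blast
qed

lemma graph_dist_stacked_book_le:
  assumes "u < m" "v < m" "i < n" "j < n"
  shows "int (graph_dist (stacked_book m n) (u, i) (v, j))
    \<le> of_bool (u \<noteq> 0) + \<bar>int i - int j\<bar> + of_bool (v \<noteq> 0)"
  using ex_awalk_via_spine[OF assms] graph_dist_le[of "stacked_book m n" "(u, i)" _ "(v, j)"]
  by fastforce

text \<open>The witnesses are two different leaves, 1 and 2, at opposite ends of the path;
  \<open>m \<ge> 3\<close> provides both.\<close>

lemma graph_diam_stacked_book_ge:
  assumes "m \<ge> 3" "n > 0"
  shows "graph_diam (stacked_book m n) \<ge> n + 1"
proof -
  let ?G = "stacked_book m n"
  \<comment> \<open>\<open>g\<close> is the distance from \<open>(1, 0)\<close>: path coordinate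
    plus star distance from leaf 1. It is \<open>n + 1\<close> at \<open>(2, n - 1)\<close>.\<close>
  define g :: "nat \<times> nat \<Rightarrow> int" where
    "g = (\<lambda>(u, i). int i + (if u = 1 then 0 else if u = 0 then 1 else 2))"
  obtain p where "pre_digraph.awalk (with_proj ?G) (1, 0) p (2, n - 1)"
    using ex_awalk_via_spine[of 1 m 2 0 n "n - 1"] assms by auto
  then obtain q where q: "pre_digraph.awalk (with_proj ?G) (1, 0) q (2, n - 1)"
    "length q = graph_dist ?G (1, 0) (2, n - 1)"
    by (rule graph_dist_attained)
  have "g (2, n - 1) \<le> g (1, 0) + int (length q)"
    by (rule awalk_length_ge_potential[OF pair_graph_stacked_book _ q(1)])
      (auto simp: g_def parcs_stacked_book)
  then have "n + 1 \<le> graph_dist ?G (1, 0) (2, n - 1)"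
    using assms q(2) by (simp add: g_def of_nat_diff)
  also have "\<dots> \<le> graph_diam ?G"
    unfolding graph_diam_def
  proof (rule Max_ge)
    have "{graph_dist ?G u v |u v. u \<in> pverts ?G \<and> v \<in> pverts ?G}
        = (\<lambda>(u, v). graph_dist ?G u v) ` (pverts ?G \<times> pverts ?G)"
      by auto
    then show "finite {graph_dist ?G u v |u v. u \<in> pverts ?G \<and> v \<in> pverts ?G}"
      by (simp add: pverts_stacked_book)
    show "graph_dist ?G (1, 0) (2, n - 1)
        \<in> {graph_dist ?G u v |u v. u \<in> pverts ?G \<and> v \<in> pverts ?G}"
      using assms by (fastforce simp: pverts_stacked_book)
  qed
  finally show ?thesis .
qed

text \<open>Summing the gaps of consecutive entries counts \<open>c\<close> twice at each inner
  vertex but once at each end, hence the two correction terms.\<close>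

lemma sorted_labels_span_ge:
  fixes f :: "'a \<Rightarrow> nat" and c :: "'a \<Rightarrow> int" and D :: int
  assumes "xs \<noteq> []" "distinct xs" "sorted (map f xs)"
    and gap: "\<And>x y. x \<in> set xs \<Longrightarrow> y \<in> set xs \<Longrightarrow> x \<noteq> y \<Longrightarrow>
      2 * D - c x - c y \<le> 2 * \<bar>int (f x) - int (f y)\<bar>"
  shows "2 * D * (int (length xs) - 1) - 2 * (\<Sum>x\<leftarrow>xs. c x) + c (hd xs) + c (last xs)
    \<le> 2 * (int (f (last xs)) - int (f (hd xs)))"
  using assms
proof (induction xs rule: induct_list012)
  case (3 x y zs)
  have IH: "2 * D * (int (length (y # zs)) - 1) - 2 * (\<Sum>x\<leftarrow>y # zs. c x) + c y + c (last (y # zs))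
    \<le> 2 * (int (f (last (y # zs))) - int (f y))"
    using "3.IH"(2) "3.prems" by simp
  have "2 * D - c x - c y \<le> 2 * (int (f y) - int (f x))"
    using "3.prems"(4)[of x y] "3.prems"(2,3) by simp
  with IH show ?case by (simp add: algebra_simps)
qed auto

text \<open>Applies the telescoped bound to the vertices sorted by label; \<open>b\<close> bounds
  \<open>c\<close> from below at the unknown first and last vertex.\<close>

lemma label_span_ge:
  fixes c :: "'a \<Rightarrow> int" and D :: int
  assumes "finite (pverts G)" "pverts G \<noteq> {}" "radio_labeling G f"
    and diam: "D \<le> int (graph_diam G) + 1"
    and dist: "\<And>x y. x \<in> pverts G \<Longrightarrow> y \<in> pverts G \<Longrightarrow> 2 * int (graph_dist G x y) \<le> c x + c y"
    and min: "\<And>x. x \<in> pverts G \<Longrightarrow> b \<le> c x"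
  shows "2 * D * (int (card (pverts G)) - 1) - 2 * (\<Sum>x\<in>pverts G. c x) + 2 * b
    \<le> 2 * int (label_span G f)"
proof -
  obtain ys where ys: "set ys = pverts G" "distinct ys"
    using finite_distinct_list assms(1) by blast
  define xs where "xs = sort_key f ys"
  have xs: "set xs = pverts G" "distinct xs" "sorted (map f xs)"
    using ys by (simp_all add: xs_def)
  then have "xs \<noteq> []" using assms(2) by auto
  note xs = xs this
  have ends: "hd xs \<in> pverts G" "last xs \<in> pverts G"
    using xs(1,4) hd_in_set last_in_set by blast+
  have "2 * D * (int (length xs) - 1) - 2 * (\<Sum>x\<leftarrow>xs. c x) + c (hd xs) + c (last xs)
    \<le> 2 * (int (f (last xs)) - int (f (hd xs)))"
  proof (rule sorted_labels_span_ge[OF xs(4,2,3)])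
    fix x y assume "x \<in> set xs" "y \<in> set xs" "x \<noteq> y"
    then show "2 * D - c x - c y \<le> 2 * \<bar>int (f x) - int (f y)\<bar>"
      using assms(3) diam dist[of x y] xs(1) unfolding radio_labeling_def by force
  qed
  moreover have "f (last xs) \<le> Max (f ` pverts G)" "Min (f ` pverts G) \<le> f (hd xs)"
    using ends assms(1) by auto
  then have "int (f (last xs)) - int (f (hd xs)) \<le> int (label_span G f)"
    unfolding label_span_def by linarith
  moreover have "length xs = card (pverts G)" "(\<Sum>x\<leftarrow>xs. c x) = (\<Sum>x\<in>pverts G. c x)"
    using xs by (auto simp: distinct_card[symmetric] sum_list_distinct_conv_sum_set)
  ultimately show ?thesis using min[OF ends(1)] min[OF ends(2)] by simp
qed

text \<open>The summands are the odd numbers 1, 3, ..., 2k - 1, each occurring twice.\<close>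

lemma sum_abs_centered_odd: "(\<Sum>i<2 * k. \<bar>2 * int i + 1 - 2 * int k\<bar>) = 2 * (int k)\<^sup>2"
proof (induction k)
  case (Suc k)
  have "(\<Sum>i<2 * Suc k. \<bar>2 * int i + 1 - 2 * int (Suc k)\<bar>)
      = (\<Sum>i<Suc (Suc (2 * k)). \<bar>2 * int i - 1 - 2 * int k\<bar>)"
    by (intro sum.cong) auto
  \<comment> \<open>Removing the first term and shifting the index recentres the rest, leaving the
    sum for \<open>k\<close> and a new last term. Both end terms equal 2k + 1.\<close>
  also have "\<dots> = \<bar>- 1 - 2 * int k\<bar> + (\<Sum>i<Suc (2 * k). \<bar>2 * int (Suc i) - 1 - 2 * int k\<bar>)"
    by (subst sum.lessThan_Suc_shift) simp
  also have "(\<Sum>i<Suc (2 * k). \<bar>2 * int (Suc i) - 1 - 2 * int k\<bar>)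
      = (\<Sum>i<2 * k. \<bar>2 * int i + 1 - 2 * int k\<bar>) + (2 * int k + 1)"
    by (simp add: algebra_simps)
  finally show ?case using Suc by (simp add: power2_eq_square algebra_simps)
qed simp

theorem theorem3p4:
  fixes m n :: nat
  assumes "m \<ge> 3" and "even n" and "n > 0"
  shows "real (radio_number (stacked_book m n)) \<ge> real m * (real n)\<^sup>2 / 2 + real n - 1"
proof -
  let ?G = "stacked_book m n"
  obtain k where n: "n = 2 * k" using assms(2) by blast
  \<comment> \<open>Twice the distance to the midpoint of the spine, at height (n - 1)/2; doubling
    keeps it integral. The bound on \<open>2 d(x, y)\<close> is then the triangle inequality through
    that midpoint.\<close>
  define c :: "nat \<times> nat \<Rightarrow> int" where
    "c = (\<lambda>(u, i). 2 * of_bool (u \<noteq> 0) + \<bar>2 * int i + 1 - int n\<bar>)"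
  have fin: "finite (pverts ?G)" by (simp add: pverts_stacked_book)
  \<comment> \<open>Radio labelings exist, so the least span is attained by some
    \<open>f\<close>.\<close>
  obtain f where f: "radio_labeling ?G f" "label_span ?G f = radio_number ?G"
    using LeastI_ex[of "\<lambda>k. \<exists>f. radio_labeling ?G f \<and> label_span ?G f = k"]
      ex_radio_labeling[OF fin] unfolding radio_number_def by blast
  have "2 * (int n + 2) * (int (card (pverts ?G)) - 1) - 2 * (\<Sum>x\<in>pverts ?G. c x) + 2 * 1
    \<le> 2 * int (label_span ?G f)"
  proof (rule label_span_ge[OF fin _ f(1)])
    show "pverts ?G \<noteq> {}" using assms by (auto simp: pverts_stacked_book lessThan_empty_iff)
    show "int n + 2 \<le> int (graph_diam ?G) + 1"
      using graph_diam_stacked_book_ge[of m n] assms by simp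
    show "2 * int (graph_dist ?G x y) \<le> c x + c y" if "x \<in> pverts ?G" "y \<in> pverts ?G" for x y
    proof -
      obtain u i v j where xy: "x = (u, i)" "y = (v, j)" by fastforce
      show ?thesis
        using that graph_dist_stacked_book_le[of u m v i n j]
        unfolding xy c_def pverts_stacked_book by auto
    qed
    show "1 \<le> c x" for x
    proof -
      obtain u i where "x = (u, i)" by fastforce
      \<comment> \<open>With \<open>n = 2 k\<close> the integer inside is odd, hence
        nonzero.\<close>
      moreover have "1 \<le> \<bar>2 * int i + 1 - int n\<bar>" unfolding n by simp presburger
      ultimately show ?thesis by (simp add: c_def)
    qed
  qed
  moreover have "(\<Sum>x\<in>pverts ?G. c x) = 2 * int n * (int m - 1) + 2 * int m * (int k)\<^sup>2"
  proof -
    have "(\<Sum>u<m. of_bool (u \<noteq> 0) :: int) = int m - 1"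
    proof -
      obtain m' where "m = Suc m'" using assms(1) by (cases m) auto
      then show ?thesis by (simp only: sum.lessThan_Suc_shift) simp
    qed
    moreover have "(\<Sum>x\<in>pverts ?G. c x)
        = (\<Sum>u<m. \<Sum>i<n. 2 * of_bool (u \<noteq> 0) + \<bar>2 * int i + 1 - int n\<bar>)"
      unfolding pverts_stacked_book c_def by (subst sum.cartesian_product) simp
    moreover have "\<dots> = 2 * int n * (\<Sum>u<m. of_bool (u \<noteq> 0))
        + int m * (\<Sum>i<n. \<bar>2 * int i + 1 - int n\<bar>)"
      by (simp only: sum.distrib sum_constant sum_distrib_left card_lessThan) (simp add: algebra_simps)
    moreover have "(\<Sum>i<n. \<bar>2 * int i + 1 - int n\<bar>) = 2 * (int k)\<^sup>2"
      using sum_abs_centered_odd[of k] by (simp add: n)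
    ultimately show ?thesis by simp
  qed
  moreover have "int (card (pverts ?G)) = int m * int n"
    by (simp add: pverts_stacked_book)
  \<comment> \<open>The terms 4mn cancel; halving what remains gives this bound, which is the claim
    written with \<open>n = 2 k\<close>.\<close>
  ultimately have "2 * int m * (int k)\<^sup>2 + 2 * int k - 1 \<le> int (radio_number ?G)"
    using f(2) unfolding n by (simp add: algebra_simps power2_eq_square)
  then have "real_of_int (2 * int m * (int k)\<^sup>2 + 2 * int k - 1) \<le> real_of_int (int (radio_number ?G))"
    by (simp only: of_int_le_iff)
  then show ?thesis unfolding n by (simp add: power_mult_distrib)
qed

end
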